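(* For any integer $n\ge 1$, there exists a $(2^{2n}-1,n,p)$-QRAC such that $$p\ge \frac12+\frac{1}{2\sqrt{(2^n-1)(2^{2n}-1)}} .$$
   Context: An $(m,n,p)$-QRAC (quantum random access coding) is an encoding of $m$ bits into $n$ qubits such that any one of the $m$ bits can be recovered with probability at least $p$: for each $x\in\{0,1\}^m$ there is an $n$-qubit state $\rho_x$ (a $2^n\times 2^n$ positive semidefinite complex matrix of trace $1$), and for each $i\in\{1,\dots,m\}$ a two-outcome POVM $\{E_i,I-E_i\}$ ($E_i$ and $I-E_i$ positive semidefinite, outcome $0$ corresponding to $E_i$), such that for all $x$ and $i$ measuring $\rho_x$ with the $i$-th POVM gives outcome $x_i$ with probability at least $p$ (outcome $0$ has probability $\mathrm{Tr}(E_i\rho_x)$). *)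

theory Defs
  imports
    "HOL-Library.FuncSet"
    "Jordan_Normal_Form.Schur_Decomposition"
begin

definition mat_trace :: "'a :: comm_monoid_add mat \<Rightarrow> 'a" where
  "mat_trace A = (\<Sum>i<dim_row A. A $$ (i, i))"

(* The order on complex is that of HOL-Library.Complex_Order: 0 \<le> z says that z is real and
   nonnegative.  (A *\<^sub>v v) \<bullet>c v is the form v* A v. *)
definition psd_mat :: "nat \<Rightarrow> complex mat \<Rightarrow> bool" where
  "psd_mat d A \<longleftrightarrow> A \<in> carrier_mat d d \<and> mat_adjoint A = A \<and>
     (\<forall>v \<in> carrier_vec d. 0 \<le> (A *\<^sub>v v) \<bullet>c v)"

definition qubit_state :: "nat \<Rightarrow> complex mat \<Rightarrow> bool" where
  "qubit_state n \<rho> \<longleftrightarrow> psd_mat (2 ^ n) \<rho> \<and> mat_trace \<rho> = 1"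

(* The two-outcome POVM {E, I - E} is represented by the operator E of outcome 0. *)
definition two_outcome_povm :: "nat \<Rightarrow> complex mat \<Rightarrow> bool" where
  "two_outcome_povm n E \<longleftrightarrow> psd_mat (2 ^ n) E \<and> psd_mat (2 ^ n) (1\<^sub>m (2 ^ n) - E)"

(* The trace of a product of two positive semidefinite matrices is real, so Re only changes
   its type. *)
definition outcome_prob :: "nat \<Rightarrow> complex mat \<Rightarrow> complex mat \<Rightarrow> nat \<Rightarrow> real" where
  "outcome_prob n E \<rho> b =
     Re (mat_trace ((if b = 0 then E else 1\<^sub>m (2 ^ n) - E) * \<rho>))"

(* Bit strings in {0,1}^m are functions x with x i \<in> {0, 1} for i = 1, ..., m, fixed to
   undefined elsewhere, so that distinct functions are distinct strings. *)
definition is_QRAC :: "nat \<Rightarrow> nat \<Rightarrow> real \<Rightarrow> bool" where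
  "is_QRAC m n p \<longleftrightarrow>
     (\<exists>(\<rho> :: (nat \<Rightarrow> nat) \<Rightarrow> complex mat) (E :: nat \<Rightarrow> complex mat).
        (\<forall>x \<in> {1..m} \<rightarrow>\<^sub>E {0, 1}. qubit_state n (\<rho> x)) \<and>
        (\<forall>i \<in> {1..m}. two_outcome_povm n (E i)) \<and>
        (\<forall>x \<in> {1..m} \<rightarrow>\<^sub>E {0, 1}. \<forall>i \<in> {1..m}. outcome_prob n (E i) (\<rho> x) (x i) \<ge> p))"

end

theory Submission
  imports Defs "HOL-Analysis.L2_Norm"
begin

text \<open>Bit k is encoded along the k-th nontrivial n-qubit Pauli operator: with N = 2^n, the state is
  (I + A) / N with A = c (\<plusminus>P_1 \<plusminus> ... \<plusminus>P_m), m = N^2 - 1, and E_k = (I + P_k) / 2, so orthogonality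
  of the Pauli operators for the trace form makes every success probability 1/2 + c/2. It remains
  to see how large c may be for the state to be positive. As A is traceless, v* A v is the
  Hilbert-Schmidt inner product of A with v v* - |v|^2 I / N, so Cauchy-Schwarz gives
  |v* A v|^2 \<le> (1 - 1/N) |A|^2 |v|^4, where |A|^2 = c^2 N (N^2 - 1) by orthogonality. Hence
  I + A is positive for c = 1 / sqrt ((N - 1) (N^2 - 1)).\<close>

section \<open>Pauli matrices I, X, Y, Z (indices 0 to 3) and their tensor products\<close>

fun pauli1 :: "nat \<Rightarrow> nat \<Rightarrow> nat \<Rightarrow> complex" where
  "pauli1 0 i j = of_bool (i = j)"
| "pauli1 (Suc 0) i j = of_bool (i \<noteq> j)"
| "pauli1 (Suc (Suc 0)) i j = (if i = j then 0 else if i = 0 then - \<i> else \<i>)"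
| "pauli1 _ i j = (if i = j then (- 1) ^ i else 0)"

text \<open>The base-4 digits of k select the n tensor factors, and the base-2 digits of i and j index their
  rows and columns; k = 0 gives the identity.\<close>
fun pauli :: "nat \<Rightarrow> nat \<Rightarrow> nat \<Rightarrow> nat \<Rightarrow> complex" where
  "pauli 0 k i j = 1"
| "pauli (Suc n) k i j =
     pauli1 (k mod 4) (i mod 2) (j mod 2) * pauli n (k div 4) (i div 2) (j div 2)"

lemma less_4_cases: "(a :: nat) < 4 \<Longrightarrow> a = 0 \<or> a = Suc 0 \<or> a = Suc (Suc 0) \<or> a = Suc (Suc (Suc 0))"
  by auto

lemma cnj_pauli1: "a < 4 \<Longrightarrow> i < 2 \<Longrightarrow> j < 2 \<Longrightarrow> cnj (pauli1 a i j) = pauli1 a j i"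
  by (drule less_4_cases) (auto simp: less_2_cases_iff)

lemma pauli1_square:
  "a < 4 \<Longrightarrow> i < 2 \<Longrightarrow> l < 2 \<Longrightarrow>
   pauli1 a i 0 * pauli1 a 0 l + pauli1 a i (Suc 0) * pauli1 a (Suc 0) l = of_bool (i = l)"
  by (drule less_4_cases) (auto simp: less_2_cases_iff)

text \<open>Written out and bracketed as the one-qubit factor appears in the induction step of
  \<open>pauli_orthogonal\<close>.\<close>

lemma pauli1_orthogonal:
  assumes "a < 4" "b < 4"
  shows "pauli1 a 0 0 * pauli1 b 0 0 + pauli1 a 0 (Suc 0) * pauli1 b (Suc 0) 0 +
    (pauli1 a (Suc 0) 0 * pauli1 b 0 (Suc 0) + pauli1 a (Suc 0) (Suc 0) * pauli1 b (Suc 0) (Suc 0))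
    = 2 * of_bool (a = b)"
  using less_4_cases[OF assms(1)] less_4_cases[OF assms(2)] by auto

text \<open>Splits off the last bit of the index, to match the \<open>mod 2\<close> and
  \<open>div 2\<close> recursion of \<open>pauli\<close>.\<close>

lemma sum_lessThan_double:
  fixes f :: "nat \<Rightarrow> 'a :: comm_monoid_add"
  shows "(\<Sum>i<2 * m. f i) = (\<Sum>i<m. f (2 * i) + f (Suc (2 * i)))"
  by (induction m) (auto simp: algebra_simps)

lemma cnj_pauli: "cnj (pauli n k i j) = pauli n k j i"
  by (induction n arbitrary: k i j) (auto simp: cnj_pauli1)

lemma pauli_0: "i < 2 ^ n \<Longrightarrow> j < 2 ^ n \<Longrightarrow> pauli n 0 i j = of_bool (i = j)"
proof (induction n arbitrary: i j)
  case (Suc n)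
  have "i = j \<longleftrightarrow> i mod 2 = j mod 2 \<and> i div 2 = j div 2"
    by (metis div_mult_mod_eq)
  with Suc show ?case
    by (auto simp: less_mult_imp_div_less mult.commute)
qed auto

lemma pauli_square:
  "i < 2 ^ n \<Longrightarrow> l < 2 ^ n \<Longrightarrow> (\<Sum>j<2 ^ n. pauli n k i j * pauli n k j l) = of_bool (i = l)"
proof (induction n arbitrary: i l k)
  case (Suc n)
  let ?s = "pauli1 (k mod 4)" and ?p = "pauli n (k div 4)"
  have "(\<Sum>j<2 ^ Suc n. pauli (Suc n) k i j * pauli (Suc n) k j l) =
    (\<Sum>j<2 ^ n. (?s (i mod 2) 0 * ?s 0 (l mod 2) + ?s (i mod 2) (Suc 0) * ?s (Suc 0) (l mod 2)) *
       (?p (i div 2) j * ?p j (l div 2)))"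
    by (simp add: sum_lessThan_double) (simp add: algebra_simps)
  also have "\<dots> = of_bool (i mod 2 = l mod 2) * of_bool (i div 2 = l div 2)"
    using Suc by (simp add: pauli1_square less_mult_imp_div_less flip: sum_distrib_left)
  also have "\<dots> = of_bool (i = l)"
    by (simp, metis div_mult_mod_eq)
  finally show ?case .
qed simp

text \<open>The trace of a product of two tensor products is the product of the traces over the
  factors, and each qubit contributes 2 or 0.\<close>

lemma pauli_orthogonal:
  "k < 4 ^ n \<Longrightarrow> l < 4 ^ n \<Longrightarrow>
   (\<Sum>i<2 ^ n. \<Sum>j<2 ^ n. pauli n k i j * pauli n l j i) = 2 ^ n * of_bool (k = l)"
proof (induction n arbitrary: k l)
  case (Suc n)
  let ?s = "pauli1 (k mod 4)" and ?t = "pauli1 (l mod 4)"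
  let ?p = "pauli n (k div 4)" and ?q = "pauli n (l div 4)"
  have "(\<Sum>i<2 ^ Suc n. \<Sum>j<2 ^ Suc n. pauli (Suc n) k i j * pauli (Suc n) l j i) =
    (\<Sum>i<2 ^ n. \<Sum>j<2 ^ n.
      (?s 0 0 * ?t 0 0 + ?s 0 (Suc 0) * ?t (Suc 0) 0 +
       (?s (Suc 0) 0 * ?t 0 (Suc 0) + ?s (Suc 0) (Suc 0) * ?t (Suc 0) (Suc 0))) *
       (?p i j * ?q j i))"
    by (simp add: sum_lessThan_double) (simp add: algebra_simps sum.distrib)
  also have "\<dots> = 2 * of_bool (k mod 4 = l mod 4) * (2 ^ n * of_bool (k div 4 = l div 4))"
    using Suc by (simp add: pauli1_orthogonal less_mult_imp_div_less flip: sum_distrib_left)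
  also have "\<dots> = 2 ^ Suc n * of_bool (k = l)"
    by (simp, metis div_mult_mod_eq)
  finally show ?case .
qed simp

section \<open>Criteria for positive semidefiniteness\<close>

lemma psd_matI:
  assumes "\<And>i j. i < d \<Longrightarrow> j < d \<Longrightarrow> cnj (f i j) = f j i"
    and "\<And>v :: nat \<Rightarrow> complex. 0 \<le> (\<Sum>i<d. \<Sum>j<d. f i j * v j * cnj (v i))"
  shows "psd_mat d (mat d d (\<lambda>(i, j). f i j))"
  unfolding psd_mat_def
proof (intro conjI ballI)
  show "mat_adjoint (mat d d (\<lambda>(i, j). f i j)) = mat d d (\<lambda>(i, j). f i j)"
    by (rule eq_matI) (auto simp: mat_adjoint_def mat_of_rows_def assms(1))
next
  fix v :: "complex vec"
  assume v: "v \<in> carrier_vec d"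
  have "(mat d d (\<lambda>(i, j). f i j) *\<^sub>v v) \<bullet>c v =
    (\<Sum>i<d. \<Sum>j<d. f i j * v $ j * cnj (v $ i))"
    using v by (auto simp: scalar_prod_def sum_distrib_right atLeast0LessThan intro!: sum.cong)
  then show "0 \<le> (mat d d (\<lambda>(i, j). f i j) *\<^sub>v v) \<bullet>c v"
    using assms(2) by simp
qed auto

text \<open>For a hermitian projection P, the form v* P v equals v* P* P v, which is the squared
  norm of Pv.\<close>

lemma psd_mat_idempotent:
  assumes "\<And>i j. i < d \<Longrightarrow> j < d \<Longrightarrow> cnj (f i j) = f j i"
    and "\<And>i j. i < d \<Longrightarrow> j < d \<Longrightarrow> (\<Sum>k<d. f i k * f k j) = f i j"
  shows "psd_mat d (mat d d (\<lambda>(i, j). f i j))"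
proof (rule psd_matI)
  fix v :: "nat \<Rightarrow> complex"
  have "(\<Sum>i<d. \<Sum>j<d. f i j * v j * cnj (v i)) =
    (\<Sum>i<d. \<Sum>j<d. \<Sum>k<d. f i k * f k j * v j * cnj (v i))"
    by (intro sum.cong refl) (simp add: assms(2) flip: sum_distrib_right)
  also have "\<dots> = (\<Sum>k<d. \<Sum>i<d. \<Sum>j<d. f i k * f k j * v j * cnj (v i))"
    by (subst (2) sum.swap, subst sum.swap) (rule refl)
  also have "\<dots> = (\<Sum>k<d. cnj (\<Sum>j<d. f k j * v j) * (\<Sum>j<d. f k j * v j))"
    unfolding cnj_sum sum_product by (intro sum.cong refl) (simp add: assms(1) mult_ac)
  also have "\<dots> = of_real (\<Sum>k<d. (cmod (\<Sum>j<d. f k j * v j))\<^sup>2)"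
    unfolding of_real_sum by (intro sum.cong refl) (metis complex_norm_square mult.commute)
  also have "0 \<le> \<dots>"
    by (simp add: sum_nonneg less_eq_complex_def)
  finally show "0 \<le> (\<Sum>i<d. \<Sum>j<d. f i j * v j * cnj (v i))" .
qed (use assms in auto)

section \<open>Cauchy-Schwarz and positivity of I + A for traceless A\<close>

lemma cmod_sum_mult_le:
  fixes f g :: "'a \<Rightarrow> complex"
  shows "(cmod (\<Sum>i\<in>A. f i * g i))\<^sup>2 \<le> (\<Sum>i\<in>A. (cmod (f i))\<^sup>2) * (\<Sum>i\<in>A. (cmod (g i))\<^sup>2)"
proof -
  have "cmod (\<Sum>i\<in>A. f i * g i) \<le> (\<Sum>i\<in>A. \<bar>cmod (f i)\<bar> * \<bar>cmod (g i)\<bar>)"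
    by (rule order_trans[OF norm_sum]) (simp add: norm_mult)
  also have "\<dots> \<le> L2_set (\<lambda>i. cmod (f i)) A * L2_set (\<lambda>i. cmod (g i)) A"
    by (rule L2_set_mult_ineq)
  finally have "(cmod (\<Sum>i\<in>A. f i * g i))\<^sup>2 \<le> (L2_set (\<lambda>i. cmod (f i)) A * L2_set (\<lambda>i. cmod (g i)) A)\<^sup>2"
    by (intro power_mono) auto
  then show ?thesis
    by (simp add: L2_set_def power_mult_distrib sum_nonneg)
qed

lemma quadratic_form_traceless_le:
  fixes a :: "nat \<Rightarrow> nat \<Rightarrow> complex" and v :: "nat \<Rightarrow> complex"
  assumes "(\<Sum>i<d. a i i) = 0" and "d > 0"
  shows "(cmod (\<Sum>i<d. \<Sum>j<d. a i j * v j * cnj (v i)))\<^sup>2 * d \<le>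
    (real d - 1) * (\<Sum>i<d. \<Sum>j<d. (cmod (a i j))\<^sup>2) * (\<Sum>i<d. (cmod (v i))\<^sup>2)\<^sup>2"
proof -
  define V where "V = (\<Sum>i<d. (cmod (v i))\<^sup>2)"
  define q where "q = (\<Sum>i<d. \<Sum>j<d. a i j * v j * cnj (v i))"
  \<comment> \<open>The transpose of d v v* - |v|^2 I, that is, the matrix paired with A, scaled by
    \<open>d\<close> to avoid division. Subtracting the identity part costs nothing because A is
    traceless, and it lowers the squared norm from d^2 V^2 to d (d - 1) V^2.\<close>
  define b where "b i j = d * (v j * cnj (v i)) - V * of_bool (i = j)" for i j
  have "(\<Sum>j<d. a i j * b i j) = d * (\<Sum>j<d. a i j * v j * cnj (v i)) - V * a i i"
    if "i < d" for i
  proof -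
    have "a i j * b i j = d * (a i j * v j * cnj (v i)) - (if j = i then V * a i i else 0)" for j
      by (simp add: b_def algebra_simps)
    then show ?thesis
      using that by (simp add: sum_subtractf sum_distrib_left)
  qed
  then have "(\<Sum>i<d. \<Sum>j<d. a i j * b i j) = d * q - V * (\<Sum>i<d. a i i)"
    by (simp add: q_def sum_subtractf sum_distrib_left)
  then have dq: "(\<Sum>(i, j)\<in>{..<d} \<times> {..<d}. a i j * b i j) = d * q"
    by (simp add: assms sum.cartesian_product)
  \<comment> \<open>The identity part affects only diagonal entries, which are real; expanding their
    squares gives the correction term.\<close>
  have b2: "(cmod (b i j))\<^sup>2 = d\<^sup>2 * ((cmod (v i))\<^sup>2 * (cmod (v j))\<^sup>2) +
      (if i = j then V\<^sup>2 - 2 * d * V * (cmod (v i))\<^sup>2 else 0)" for i j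
  proof (cases "i = j")
    case True
    have "b i j = of_real (d * (cmod (v i))\<^sup>2 - V)"
      using True by (simp add: b_def flip: complex_norm_square)
    then have "(cmod (b i j))\<^sup>2 = (d * (cmod (v i))\<^sup>2 - V)\<^sup>2"
      by (simp only: norm_of_real power2_abs)
    then show ?thesis using True by (simp add: power2_eq_square algebra_simps)
  qed (simp add: b_def norm_mult power_mult_distrib)
  have "(\<Sum>i<d. \<Sum>j<d. (cmod (b i j))\<^sup>2) = d\<^sup>2 * (V * V) + (d * V\<^sup>2 - 2 * d * V * V)"
    unfolding b2 sum.distrib by (simp add: sum_subtractf sum_product flip: sum_distrib_left)
     (simp add: V_def sum_product flip: sum_distrib_left)
  also have "\<dots> = d * (real d - 1) * V\<^sup>2"
    using assms(2) by (simp add: power2_eq_square algebra_simps of_nat_diff)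
  finally have sb: "(\<Sum>(i, j)\<in>{..<d} \<times> {..<d}. (cmod (b i j))\<^sup>2) = d * (real d - 1) * V\<^sup>2"
    by (simp add: sum.cartesian_product)
  have "(cmod (d * q))\<^sup>2 \<le> (\<Sum>(i, j)\<in>{..<d} \<times> {..<d}. (cmod (a i j))\<^sup>2) * (d * (real d - 1) * V\<^sup>2)"
    using cmod_sum_mult_le[of "case_prod a" "case_prod b" "{..<d} \<times> {..<d}"]
    unfolding dq[symmetric] sb[symmetric] by (simp add: case_prod_unfold)
  then have "d * ((cmod q)\<^sup>2 * d) \<le> d * ((real d - 1) * (\<Sum>i<d. \<Sum>j<d. (cmod (a i j))\<^sup>2) * V\<^sup>2)"
    by (simp add: norm_mult power_mult_distrib sum.cartesian_product power2_eq_square mult_ac)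
  then show ?thesis
    using assms(2) unfolding V_def q_def by (subst (asm) mult_le_cancel_left_pos) auto
qed

text \<open>With \<open>hs\<close>, the preceding estimate becomes |v* A v| \<le> |v|^2, so the
  identity outweighs A. The factor \<open>t\<close> will normalize states to trace 1.\<close>

lemma psd_mat_one_plus_traceless:
  fixes a :: "nat \<Rightarrow> nat \<Rightarrow> complex"
  assumes herm: "\<And>i j. i < d \<Longrightarrow> j < d \<Longrightarrow> cnj (a i j) = a j i"
    and tr: "(\<Sum>i<d. a i i) = 0"
    and hs: "(real d - 1) * (\<Sum>i<d. \<Sum>j<d. (cmod (a i j))\<^sup>2) \<le> d"
    and "d > 0" "t \<ge> 0"
  shows "psd_mat d (mat d d (\<lambda>(i, j). of_real t * (of_bool (i = j) + a i j)))"
proof (rule psd_matI)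
  fix v :: "nat \<Rightarrow> complex"
  define V where "V = (\<Sum>i<d. (cmod (v i))\<^sup>2)"
  define q where "q = (\<Sum>i<d. \<Sum>j<d. a i j * v j * cnj (v i))"
  have "(\<Sum>j<d. of_real t * (of_bool (i = j) + a i j) * v j * cnj (v i)) =
    of_real t * ((cmod (v i))\<^sup>2 + (\<Sum>j<d. a i j * v j * cnj (v i)))" if "i < d" for i
  proof -
    have eq: "of_real t * (of_bool (i = j) + a i j) * v j * cnj (v i) =
      of_real t * ((if j = i then of_real ((cmod (v i))\<^sup>2) else 0) + a i j * v j * cnj (v i))" for j
      unfolding complex_norm_square by (simp add: algebra_simps)
    show ?thesis
      using that unfolding eq by (simp add: sum.distrib flip: sum_distrib_left)
  qed
  then have form: "(\<Sum>i<d. \<Sum>j<d. of_real t * (of_bool (i = j) + a i j) * v j * cnj (v i)) =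
    of_real t * (of_real V + q)"
    by (simp add: V_def q_def sum.distrib flip: sum_distrib_left)
  have "V \<ge> 0"
    by (simp add: V_def sum_nonneg)
  have "(cmod q)\<^sup>2 * d \<le> (real d - 1) * (\<Sum>i<d. \<Sum>j<d. (cmod (a i j))\<^sup>2) * V\<^sup>2"
    unfolding q_def V_def by (rule quadratic_form_traceless_le) fact+
  also have "\<dots> \<le> d * V\<^sup>2"
    by (intro mult_right_mono hs) simp
  finally have "(cmod q)\<^sup>2 \<le> V\<^sup>2"
    using \<open>d > 0\<close> by (simp add: mult.commute)
  then have "cmod q \<le> V"
    using \<open>V \<ge> 0\<close> by (simp add: power2_le_iff_abs_le)
  then have "V + Re q \<ge> 0"
    using abs_Re_le_cmod[of q] by linarith
  \<comment> \<open>The order on complex numbers also demands that the form be real; this follows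
    from hermiticity.\<close>
  have "cnj q = (\<Sum>i<d. \<Sum>j<d. a j i * cnj (v j) * v i)"
    by (simp add: q_def herm)
  also have "\<dots> = q"
    unfolding q_def by (subst sum.swap) (simp add: mult_ac)
  finally have "Im q = 0"
    by (simp add: complex_eq_iff)
  then show "0 \<le> (\<Sum>i<d. \<Sum>j<d. of_real t * (of_bool (i = j) + a i j) * v j * cnj (v i))"
    unfolding form using \<open>V + Re q \<ge> 0\<close> \<open>t \<ge> 0\<close> by (simp add: less_eq_complex_def)
qed (use herm in auto)

section \<open>Traces and real combinations of Pauli operators\<close>

lemma mat_trace_mat_mult:
  "mat_trace (mat d d (\<lambda>(i, j). f i j) * mat d d (\<lambda>(i, j). g i j)) =
    (\<Sum>i<d. \<Sum>j<d. f i j * g j i)"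
  by (auto simp: mat_trace_def scalar_prod_def atLeast0LessThan intro!: sum.cong)

text \<open>This is orthogonality to the identity, the operator of index 0.\<close>

lemma pauli_trace:
  assumes "k \<in> {1..<4 ^ n}"
  shows "(\<Sum>i<2 ^ n. pauli n k i i) = 0"
proof -
  have "(\<Sum>j<2 ^ n. pauli n k i j * pauli n 0 j i) = pauli n k i i" if "i < 2 ^ n" for i
  proof -
    have "(\<Sum>j<2 ^ n. pauli n k i j * pauli n 0 j i) =
      (\<Sum>j<2 ^ n. if j = i then pauli n k i i else 0)"
      using that by (auto simp: pauli_0 intro!: sum.cong)
    then show ?thesis
      using that by simp
  qed
  then show ?thesis
    using pauli_orthogonal[of k n 0] assms by simp
qed

text \<open>Leaving out index 0 keeps the operator traceless; real coefficients keep it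
  hermitian.\<close>

definition pauli_sum :: "nat \<Rightarrow> (nat \<Rightarrow> real) \<Rightarrow> nat \<Rightarrow> nat \<Rightarrow> complex" where
  "pauli_sum n s i j = (\<Sum>k\<in>{1..<4 ^ n}. of_real (s k) * pauli n k i j)"

lemma cnj_pauli_sum: "cnj (pauli_sum n s i j) = pauli_sum n s j i"
  by (simp add: pauli_sum_def cnj_pauli)

lemma pauli_sum_trace: "(\<Sum>i<2 ^ n. pauli_sum n s i i) = 0"
  unfolding pauli_sum_def by (subst sum.swap) (simp add: pauli_trace flip: sum_distrib_left)

text \<open>Orthogonality reads off one coefficient. This serves both the Hilbert-Schmidt norm and
  the outcome probabilities.\<close>

lemma pauli_pauli_sum:
  assumes "k \<in> {1..<4 ^ n}"
  shows "(\<Sum>i<2 ^ n. \<Sum>j<2 ^ n. pauli n k i j * pauli_sum n s j i) = 2 ^ n * of_real (s k)"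
proof -
  have "(\<Sum>i<2 ^ n. \<Sum>j<2 ^ n. pauli n k i j * pauli_sum n s j i) =
    (\<Sum>i<2 ^ n. \<Sum>j<2 ^ n. \<Sum>l\<in>{1..<4 ^ n}. of_real (s l) * (pauli n k i j * pauli n l j i))"
    by (simp add: pauli_sum_def sum_distrib_left mult_ac)
  also have "\<dots> = (\<Sum>l\<in>{1..<4 ^ n}. \<Sum>i<2 ^ n. \<Sum>j<2 ^ n. of_real (s l) * (pauli n k i j * pauli n l j i))"
    by (subst (2) sum.swap, subst sum.swap) (rule refl)
  also have "\<dots> = (\<Sum>l\<in>{1..<4 ^ n}. if l = k then 2 ^ n * of_real (s k) else 0)"
    using assms by (intro sum.cong refl) (auto simp: pauli_orthogonal simp flip: sum_distrib_left)
  finally show ?thesis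
    using assms by simp
qed

text \<open>Parseval's identity: by hermiticity the left side is the trace of A^2, and expanding one
  factor A reduces it to the coefficients of the other.\<close>

lemma pauli_sum_hs:
  "(\<Sum>i<2 ^ n. \<Sum>j<2 ^ n. (cmod (pauli_sum n s i j))\<^sup>2) = 2 ^ n * (\<Sum>k\<in>{1..<4 ^ n}. (s k)\<^sup>2)"
proof -
  have "complex_of_real (\<Sum>i<2 ^ n. \<Sum>j<2 ^ n. (cmod (pauli_sum n s i j))\<^sup>2) =
    (\<Sum>i<2 ^ n. \<Sum>j<2 ^ n. pauli_sum n s i j * pauli_sum n s j i)"
    unfolding of_real_sum complex_norm_square cnj_pauli_sum ..
  also have "\<dots> =
    (\<Sum>i<2 ^ n. \<Sum>j<2 ^ n. \<Sum>k\<in>{1..<4 ^ n}. of_real (s k) * (pauli n k i j * pauli_sum n s j i))"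
    by (simp add: pauli_sum_def[of n s i j for i j] sum_distrib_right mult_ac)
  also have "\<dots> =
    (\<Sum>k\<in>{1..<4 ^ n}. \<Sum>i<2 ^ n. \<Sum>j<2 ^ n. of_real (s k) * (pauli n k i j * pauli_sum n s j i))"
    by (subst (2) sum.swap, subst sum.swap) (rule refl)
  also have "\<dots> = (\<Sum>k\<in>{1..<4 ^ n}. of_real (s k) * (2 ^ n * of_real (s k)))"
    by (intro sum.cong refl) (simp only: sum_distrib_left[symmetric] pauli_pauli_sum)
  also have "\<dots> = complex_of_real (2 ^ n * (\<Sum>k\<in>{1..<4 ^ n}. (s k)\<^sup>2))"
    by (simp add: sum_distrib_left power2_eq_square mult_ac)
  finally show ?thesis
    by (simp only: of_real_eq_iff)
qed

section \<open>Measurements, states and outcome probabilities\<close>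

definition pauli_effect :: "nat \<Rightarrow> nat \<Rightarrow> real \<Rightarrow> complex mat" where
  "pauli_effect n k t =
    mat (2 ^ n) (2 ^ n) (\<lambda>(i, j). (of_bool (i = j) + of_real t * pauli n k i j) / 2)"

text \<open>For t = 1 or t = -1 the effect is the projection onto the eigenspace of P_k for
  eigenvalue t: it is idempotent because P_k squares to the identity.\<close>

lemma psd_pauli_effect:
  assumes "t\<^sup>2 = 1"
  shows "psd_mat (2 ^ n) (pauli_effect n k t)"
  unfolding pauli_effect_def
proof (rule psd_mat_idempotent)
  let ?f = "\<lambda>i j. (of_bool (i = j) + of_real t * pauli n k i j) / 2"
  fix i j :: nat
  assume ij: "i < 2 ^ n" "j < 2 ^ n"
  \<comment> \<open>The two \<open>if\<close> terms come from the identity parts and select one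
    \<open>l\<close> each; the last term sums to an identity entry by
    \<open>pauli_square\<close>.\<close>
  have eq: "?f i l * ?f l j = ((if l = i then ?f i j else 0) +
      (if l = j then of_real t * pauli n k i j / 2 else 0) +
      of_real (t\<^sup>2) * (pauli n k i l * pauli n k l j) / 2) / 2" for l
    by (simp add: field_simps power2_eq_square)
  show "(\<Sum>l<2 ^ n. ?f i l * ?f l j) = ?f i j"
    using ij unfolding eq by (simp add: sum.distrib pauli_square assms add_divide_distrib flip: sum_divide_distrib sum_distrib_left)
qed (auto simp: cnj_pauli)

lemma one_minus_pauli_effect: "1\<^sub>m (2 ^ n) - pauli_effect n k t = pauli_effect n k (- t)"
  by (rule eq_matI) (auto simp: pauli_effect_def field_simps)

text \<open>Here \<open>s\<close> is the generalized Bloch vector of the state.\<close>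

definition bloch_state :: "nat \<Rightarrow> (nat \<Rightarrow> real) \<Rightarrow> complex mat" where
  "bloch_state n s =
    mat (2 ^ n) (2 ^ n) (\<lambda>(i, j). of_real (1 / 2 ^ n) * (of_bool (i = j) + pauli_sum n s i j))"

text \<open>By Parseval, the hypothesis multiplied by 2^n is the norm bound \<open>hs\<close>. For n
  \<ge> 1 it places the Bloch vector in the ball of radius 1 / sqrt (2^n - 1).\<close>

lemma qubit_state_bloch_state:
  assumes "(2 ^ n - 1) * (\<Sum>k\<in>{1..<4 ^ n}. (s k)\<^sup>2) \<le> 1"
  shows "qubit_state n (bloch_state n s)"
  unfolding qubit_state_def
proof
  have "(real (2 ^ n) - 1) * (\<Sum>i<2 ^ n. \<Sum>j<2 ^ n. (cmod (pauli_sum n s i j))\<^sup>2) \<le> real (2 ^ n)"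
    using mult_left_mono[OF assms, of "2 ^ n"] by (simp add: pauli_sum_hs mult_ac)
  then show "psd_mat (2 ^ n) (bloch_state n s)"
    unfolding bloch_state_def
    by (intro psd_mat_one_plus_traceless) (simp_all add: cnj_pauli_sum pauli_sum_trace)
  show "mat_trace (bloch_state n s) = 1"
    by (simp add: mat_trace_def bloch_state_def sum.distrib pauli_sum_trace flip: sum_divide_distrib)
qed

text \<open>Of the four products of summands, the two identities give the constant 1/2, the mixed
  terms are traceless, and the last one reads off the coefficient \<open>s k\<close>.\<close>

lemma mat_trace_pauli_effect_bloch_state:
  assumes "k \<in> {1..<4 ^ n}"
  shows "mat_trace (pauli_effect n k t * bloch_state n s) = of_real ((1 + t * s k) / 2)"
proof -
  let ?A = "pauli_sum n s"
  have "(\<Sum>j<2 ^ n. (of_bool (i = j) + of_real t * pauli n k i j) / 2 *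
      (of_real (1 / 2 ^ n) * (of_bool (j = i) + ?A j i))) =
    (1 + ?A i i + of_real t * pauli n k i i +
      of_real t * (\<Sum>j<2 ^ n. pauli n k i j * ?A j i)) / (2 * 2 ^ n)" if "i < 2 ^ n" for i
  proof -
    have "(of_bool (i = j) + of_real t * pauli n k i j) / 2 *
        (of_real (1 / 2 ^ n) * (of_bool (j = i) + ?A j i)) =
      ((if j = i then 1 + ?A i i + of_real t * pauli n k i i else 0) +
        of_real t * (pauli n k i j * ?A j i)) / (2 * 2 ^ n)" for j
      by (simp add: field_simps)
    then show ?thesis
      using that by (simp add: sum.distrib flip: sum_divide_distrib sum_distrib_left)
  qed
  then have "mat_trace (pauli_effect n k t * bloch_state n s) =
    (2 ^ n + (\<Sum>i<2 ^ n. ?A i i) + of_real t * (\<Sum>i<2 ^ n. pauli n k i i) +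
      of_real t * (\<Sum>i<2 ^ n. \<Sum>j<2 ^ n. pauli n k i j * ?A j i)) / (2 * 2 ^ n)"
    unfolding pauli_effect_def bloch_state_def mat_trace_mat_mult
    by (simp add: sum.distrib flip: sum_divide_distrib sum_distrib_left)
  also have "\<dots> = of_real ((1 + t * s k) / 2)"
    using assms by (simp add: pauli_sum_trace pauli_trace pauli_pauli_sum field_simps)
  finally show ?thesis .
qed

theorem theorem5p4:
  fixes n :: nat
  assumes "n \<ge> 1"
  shows "\<exists>p :: real. is_QRAC (2 ^ (2 * n) - 1) n p \<and>
           p \<ge> 1 / 2 + 1 / (2 * sqrt ((2 ^ n - 1) * (2 ^ (2 * n) - 1)))"
proof -
  define c :: real where "c = 1 / sqrt ((2 ^ n - 1) * (2 ^ (2 * n) - 1))"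
  \<comment> \<open>Bit 0 gets the positive sign because outcome 0 belongs to the eigenvalue 1 of
    P_k.\<close>
  define s :: "(nat \<Rightarrow> nat) \<Rightarrow> nat \<Rightarrow> real" where "s x k = (if x k = 0 then c else - c)" for x k
  \<comment> \<open>The bit positions are exactly the indices of the nontrivial Pauli
    operators.\<close>
  have m: "{1..2 ^ (2 * n) - 1} = {1..<4 ^ n :: nat}"
    by (auto simp: power_mult simp flip: Suc_le_eq)
  \<comment> \<open>Here n \<ge> 1 ensures that the root in \<open>c\<close> is nonzero. The choice
    of \<open>c\<close> then meets the condition of \<open>qubit_state_bloch_state\<close> with
    equality.\<close>
  have "(2 :: real) ^ n > 1" "(2 :: real) ^ (2 * n) > 1"
    using assms by (simp_all add: one_less_power)
  then have "(2 ^ n - 1) * ((2 ^ (2 * n) - 1) * c\<^sup>2) = 1"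
    by (simp add: c_def power_divide)
  moreover have "(\<Sum>k\<in>{1..<4 ^ n}. (s x k)\<^sup>2) = (2 ^ (2 * n) - 1) * c\<^sup>2" for x
  proof -
    have "(s x k)\<^sup>2 = c\<^sup>2" for k
      by (simp add: s_def)
    then show ?thesis
      by (simp add: power_mult of_nat_diff)
  qed
  ultimately have "qubit_state n (bloch_state n (s x))" for x
    by (intro qubit_state_bloch_state) simp
  moreover have "two_outcome_povm n (pauli_effect n k 1)" for k
    by (simp add: two_outcome_povm_def psd_pauli_effect one_minus_pauli_effect)
  \<comment> \<open>For bit 1 the complementary effect has t = -1 and the coefficient is -c, so t
    times the coefficient is \<open>c\<close> for both bit values.\<close>
  moreover have "outcome_prob n (pauli_effect n k 1) (bloch_state n (s x)) (x k) = 1 / 2 + c / 2"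
    if "k \<in> {1..<4 ^ n}" for x k
    using that by (simp add: outcome_prob_def one_minus_pauli_effect
      mat_trace_pauli_effect_bloch_state s_def add_divide_distrib)
  ultimately have "is_QRAC (2 ^ (2 * n) - 1) n (1 / 2 + c / 2)"
    unfolding is_QRAC_def m
    by (intro exI[of _ "\<lambda>x. bloch_state n (s x)"] exI[of _ "\<lambda>k. pauli_effect n k 1"]) simp
  then show ?thesis
    by (intro exI[of _ "1 / 2 + c / 2"]) (simp add: c_def)
qed

end
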